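(* The map $$\pi\colon I_{R_3}\setminus\partial\mathcal{M}(f_3^\star)\to F_{\mathbb{A}}^{\mathbb{N}}\setminus\big\{\underline\xi\in F_{\mathbb{A}}^{\mathbb{N}}:\ \exists\,n\in\mathbb{Z}_{\ge0}:\ \tau^n(\underline\xi)=\pm\underline{r}_3\big\},$$ given by $\pi(x)=\underline\xi=(\xi_i)_{i\in\mathbb{N}}$ if $(f_3^\star)^{i-1}(x)\in J^\star_{\xi_i}$ for all $i\in\mathbb{N}$, is bijective, and $\pi\circ f_3^\star=\tau\circ\pi$. Its inverse can be defined on the entire set $F_{\mathbb{A}}^{\mathbb{N}}$, as the map $\pi^{-1}\colon F_{\mathbb{A}}^{\mathbb{N}}\to I_{R_3}$ given by $\pi^{-1}(\underline\xi)=x$, with $x$ the unique point of $I_{R_3}$ with $x\in J^\star_{\xi_1}\cap\bigcap_{l=1}^\infty(f^\star_{\xi_l}\circ\cdots\circ f^\star_{\xi_1})^{-1}J^\star_{\xi_{l+1}}$.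
   Context: Here $q=3$ and $\lambda_3=1$. Let $R_3=\frac{\sqrt5-1}{2}$, $r_3=R_3-1=\frac{\sqrt5-3}{2}$, and $I_{R_3}=[-R_3,R_3]$. For $x\ge0$ let $\langle x\rangle^\star$ be the integer $n$ with $n+r_3\le x<n+R_3$, and for $x<0$ put $\langle x\rangle^\star=-\langle-x\rangle^\star$. The map $f_3^\star\colon I_{R_3}\to I_{R_3}$ is $f_3^\star(y)=-\frac1y-\langle-\frac1y\rangle^\star$ for $y\ne0$, $f_3^\star(0)=0$. For $m\ge2$ let $J_m^\star=\big[\frac{-1}{r_3+m},\frac{-1}{r_3+m+1}\big]$ and $J_{-m}^\star=-J_m^\star$. For $m\in\mathbb{Z}\setminus\{0,\pm1\}$, $f_m^\star$ denotes the branch of $f_3^\star$ on $J_m^\star$, i.e. $f_m^\star(x)=-\frac1x-m$ for $x\in J_m^\star$. The condition $x\in J^\star_{\xi_1}\cap\bigcap_{l\ge1}(f^\star_{\xi_l}\circ\cdots\circ f^\star_{\xi_1})^{-1}J^\star_{\xi_{l+1}}$ means that $x\in J^\star_{\xi_1}$ and successively $f^\star_{\xi_l}\circ\cdots\circ f^\star_{\xi_1}(x)\in J^\star_{\xi_{l+1}}$ for all $l\ge1$. Alphabet $F=\mathbb{Z}\setminus\{0,\pm1\}$; transition matrix $\mathbb{A}=(\mathbb{A}_{m,n})_{m,n\in F}$ with $\mathbb{A}_{m,n}=1$ if $n\ne2\,\mathrm{sign}(m)$ and $\mathbb{A}_{m,n}=0$ otherwise. $F_{\mathbb{A}}^{\mathbb{N}}=\{(\xi_i)_{i\in\mathbb{N}}:\xi_i\in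 F,\ \mathbb{A}_{\xi_i,\xi_{i+1}}=1\ \forall i\in\mathbb{N}\}$, with shift $(\tau\underline\xi)_i=\xi_{i+1}$. The sequence $\pm\underline{r}_3$ is the constant sequence with all entries $\pm3$. Finally $\partial\mathcal{M}(f_3^\star)=\{y\in I_{R_3}:\exists\,n\in\mathbb{Z}_{\ge0}\text{ with }(f_3^\star)^n(y)=\pm r_3\text{ or }(f_3^\star)^n(y)=0\}$. *)

theory Defs imports Complex_Main begin

definition R3 :: real where "R3 = (sqrt 5 - 1) / 2"

definition r3 :: real where "r3 = R3 - 1"

definition I_R3 :: "real set" where "I_R3 = {- R3 .. R3}"

text \<open>The description is proper: \<open>[r3, R3)\<close> has length 1, so exactly one of its
  translates by integers contains \<open>x\<close>.\<close>

definition nearest_int_nonneg :: "real \<Rightarrow> int" where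
  "nearest_int_nonneg x = (THE n :: int. of_int n + r3 \<le> x \<and> x < of_int n + R3)"

definition nearest_int_star :: "real \<Rightarrow> int" where
  "nearest_int_star x = (if x \<ge> 0 then nearest_int_nonneg x else - nearest_int_nonneg (- x))"

definition f_star :: "real \<Rightarrow> real" where
  "f_star y = (if y = 0 then 0 else - 1 / y - of_int (nearest_int_star (- 1 / y)))"

definition boundary_M :: "real set" where
  "boundary_M = {y \<in> I_R3. \<exists>n::nat.
     (f_star ^^ n) y = r3 \<or> (f_star ^^ n) y = - r3 \<or> (f_star ^^ n) y = 0}"

definition alphabet :: "int set" where "alphabet = UNIV - {0, 1, - 1}"

definition J_pos :: "int \<Rightarrow> real set" where
  "J_pos m = {- 1 / (r3 + of_int m) .. - 1 / (r3 + of_int m + 1)}"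

text \<open>The intervals are only meaningful for indices in the alphabet; the empty set elsewhere
  is a dummy value.\<close>

definition J_star :: "int \<Rightarrow> real set" where
  "J_star m = (if m \<ge> 2 then J_pos m else if m \<le> - 2 then uminus ` J_pos (- m) else {})"

text \<open>The formula of the branch of \<^const>\<open>f_star\<close> on \<open>J_star m\<close>, extended by the same
  formula to all reals; it is only ever evaluated below at points required to lie in \<open>J_star m\<close>.
  At one endpoint of \<open>J_star m\<close> it differs from \<^const>\<open>f_star\<close>: the branch is continuous on the
  closed interval.\<close>

definition f_branch :: "int \<Rightarrow> real \<Rightarrow> real" where
  "f_branch m x = - 1 / x - of_int m"

definition trans_matrix :: "int \<Rightarrow> int \<Rightarrow> nat" where
  "trans_matrix m n = (if n \<noteq> 2 * sgn m then 1 else 0)"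

text \<open>Sequences are indexed from 0: the value \<open>\<xi> i\<close> is the entry that is written with
  index \<open>i + 1\<close> when sequences start at 1.\<close>

definition F_A :: "(nat \<Rightarrow> int) set" where
  "F_A = {\<xi>. (\<forall>i. \<xi> i \<in> alphabet) \<and> (\<forall>i. trans_matrix (\<xi> i) (\<xi> (Suc i)) = 1)}"

definition shift :: "(nat \<Rightarrow> int) \<Rightarrow> (nat \<Rightarrow> int)" where
  "shift \<xi> = (\<lambda>i. \<xi> (Suc i))"

definition r3_seq :: "nat \<Rightarrow> int" where "r3_seq = (\<lambda>_. 3)"

definition minus_r3_seq :: "nat \<Rightarrow> int" where "minus_r3_seq = (\<lambda>_. - 3)"

definition F_A_reg :: "(nat \<Rightarrow> int) set" where
  "F_A_reg = F_A - {\<xi> \<in> F_A. \<exists>n::nat. (shift ^^ n) \<xi> = r3_seq \<or> (shift ^^ n) \<xi> = minus_r3_seq}"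

definition is_itinerary :: "real \<Rightarrow> (nat \<Rightarrow> int) \<Rightarrow> bool" where
  "is_itinerary x \<xi> \<longleftrightarrow> (\<forall>i. \<xi> i \<in> alphabet \<and> (f_star ^^ i) x \<in> J_star (\<xi> i))"

definition coding :: "real \<Rightarrow> (nat \<Rightarrow> int)" where
  "coding x = (THE \<xi>. is_itinerary x \<xi>)"

text \<open>\<open>branch_comp \<xi> l\<close> is the composition of the branches with indices \<open>\<xi> 0, \<dots>, \<xi> (l - 1)\<close>,
  the one with index \<open>\<xi> 0\<close> being applied first.\<close>

primrec branch_comp :: "(nat \<Rightarrow> int) \<Rightarrow> nat \<Rightarrow> real \<Rightarrow> real" where
  "branch_comp \<xi> 0 = id"
| "branch_comp \<xi> (Suc l) = f_branch (\<xi> l) \<circ> branch_comp \<xi> l"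

definition follows_branches :: "(nat \<Rightarrow> int) \<Rightarrow> real \<Rightarrow> bool" where
  "follows_branches \<xi> x \<longleftrightarrow>
     x \<in> J_star (\<xi> 0) \<inter> (\<Inter>l\<in>{1..}. branch_comp \<xi> l -` J_star (\<xi> l))"

definition decoding :: "(nat \<Rightarrow> int) \<Rightarrow> real" where
  "decoding \<xi> = (THE x. x \<in> I_R3 \<and> follows_branches \<xi> x)"

end

theory Submission imports Defs begin

text \<open>The branch \<open>f_branch m\<close> maps \<open>J_star m\<close> homeomorphically onto \<open>[r3, R3]\<close> if \<open>m > 0\<close> and
  onto \<open>[- R3, - r3]\<close> if \<open>m < 0\<close>, and this image contains exactly those \<open>J_star n\<close> that may follow
  \<open>m\<close>. The inverse branches contract by the factor \<open>R3\<^sup>2 < 1\<close>, so every admissible sequence is followed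
  by exactly one point, the limit of the inverse branches along the sequence. The map \<open>f_star\<close>
  differs from the branch only where the branch takes the value \<open>\<plusminus>R3\<close>; the points \<open>\<plusminus>R3\<close> and
  \<open>\<plusminus>r3\<close> are only followed by sequences that end in the constant sequence \<open>3\<close> or \<open>- 3\<close>.\<close>

section \<open>Inverse branches and continued fraction approximants\<close>

definition branch_range :: "int \<Rightarrow> real set" where
  "branch_range m = (if m > 0 then {r3..R3} else {- R3..- r3})"

definition inv_branch :: "int \<Rightarrow> real \<Rightarrow> real" where
  "inv_branch m w = - 1 / (w + of_int m)"

text \<open>The finite continued fraction with digits \<open>\<xi> 0\<close> to
  \<open>\<xi> n\<close>, built from \<open>- 1 / (m + w)\<close>. Its innermost tail is
  \<open>R3\<close> or \<open>- R3\<close> according to the sign of \<open>\<xi> n\<close>: an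
  endpoint of the range of that branch, so that no approximant leaves
  \<open>J_star (\<xi> 0)\<close>.\<close>

primrec approx_point :: "nat \<Rightarrow> (nat \<Rightarrow> int) \<Rightarrow> real" where
  "approx_point 0 \<xi> = inv_branch (\<xi> 0) (of_int (sgn (\<xi> 0)) * R3)"
| "approx_point (Suc n) \<xi> = inv_branch (\<xi> 0) (approx_point n (shift \<xi>))"

definition limit_point :: "(nat \<Rightarrow> int) \<Rightarrow> real" where
  "limit_point \<xi> = lim (\<lambda>n. approx_point n \<xi>)"

section \<open>Arithmetic of \<open>R3\<close> and \<open>r3\<close>\<close>

lemma R3_gt: "1 / 2 < R3" and R3_less: "R3 < 1"
proof -
  have "2 < sqrt 5" by (rule real_less_rsqrt) simp
  moreover have "sqrt 5 < 3" by (rule real_less_lsqrt) simp_all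
  ultimately show "1 / 2 < R3" "R3 < 1" by (simp_all add: R3_def)
qed

text \<open>\<open>R3\<close> is the positive root of \<open>x * x + x - 1\<close>. The reciprocals
  of \<open>R3\<close> and \<open>r3\<close> computed from this show that the branches permute the
  endpoints up to integer translation.\<close>

lemma R3_squared: "R3 * R3 = 1 - R3"
proof -
  have "sqrt 5 * sqrt 5 = (5::real)" by simp
  then show ?thesis by (simp add: R3_def field_simps)
qed

lemma inverse_R3: "1 / R3 = 1 + R3"
  using R3_squared R3_gt by (simp add: field_simps)

lemma inverse_r3: "1 / r3 = - 2 - R3"
proof -
  have "(- 2 - R3) * r3 = 1" using R3_squared by (simp add: r3_def algebra_simps)
  moreover have "r3 \<noteq> 0" using R3_less by (simp add: r3_def)
  ultimately show ?thesis by (simp add: field_simps)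
qed

lemma r3_bounds: "- R3 < r3" "r3 < 0" "r3 + 1 = R3"
  using R3_gt R3_less by (simp_all add: r3_def)

section \<open>Intervals and their branches\<close>

lemma f_branch_inv_branch [simp]: "f_branch m (inv_branch m w) = w"
  by (simp add: f_branch_def inv_branch_def)

lemma f_branch_uminus: "f_branch (- m) (- y) = - f_branch m y"
  by (simp add: f_branch_def)

lemma mem_J_pos_iff:
  assumes "m \<ge> 2"
  shows "y \<in> J_pos m \<longleftrightarrow> f_branch m y \<in> {r3..R3}"
proof -
  have m: "real_of_int m \<ge> 2" using assms by simp
  have 1: "r3 + of_int m > 0" using m R3_gt by (simp add: r3_def)
  show ?thesis
  proof (cases "y < 0")
    case True
    then show ?thesis using 1 m
      by (auto simp: J_pos_def f_branch_def r3_def field_simps)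
  next
    case False
    have "- 1 / (r3 + of_int m + 1) < 0" using 1 by (simp add: field_simps)
    then have "y \<notin> J_pos m" using False unfolding J_pos_def atLeastAtMost_iff by linarith
    \<comment> \<open>This includes \<open>y = 0\<close>, where the quotient is 0 by convention; the
      branch value is then at most \<open>- m\<close>, which is below \<open>r3\<close>.\<close>
    moreover have "- 1 / y \<le> 0" using False by simp
    then have "f_branch m y < r3" using 1 unfolding f_branch_def by linarith
    ultimately show ?thesis by simp
  qed
qed

text \<open>Testing membership on the value of the branch replaces endpoints that depend on
  \<open>m\<close> by the fixed numbers \<open>r3\<close> and \<open>R3\<close> up to sign. Negative
  indices reduce to positive ones because
  \<open>f_branch (- m) (- y) = - f_branch m y\<close>.\<close>

lemma mem_J_star_iff: "y \<in> J_star m \<longleftrightarrow> m \<in> alphabet \<and> f_branch m y \<in> branch_range m"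
proof -
  consider "m \<ge> 2" | "m \<le> - 2" | "m \<in> {-1, 0, 1}" by fastforce
  then show ?thesis
  proof cases
    case 1
    then show ?thesis
      by (auto simp: J_star_def branch_range_def alphabet_def mem_J_pos_iff)
  next
    case 2
    have "y \<in> uminus ` J_pos (- m) \<longleftrightarrow> - y \<in> J_pos (- m)" by force
    then show ?thesis using 2 mem_J_pos_iff[of "- m" "- y"]
      by (auto simp: J_star_def branch_range_def alphabet_def f_branch_uminus)
  next
    case 3
    then show ?thesis by (auto simp: J_star_def alphabet_def)
  qed
qed

lemma alphabet_cases:
  assumes "m \<in> alphabet"
  obtains "m \<ge> 2" | "m \<le> - 2"
  using assms by (fastforce simp: alphabet_def)

text \<open>The left endpoint \<open>- 1 / (r3 + m)\<close> increases with \<open>m\<close>. It is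
  \<open>- R3\<close> for \<open>m = 2\<close>, since \<open>r3 + 2 = 1 / R3\<close>, and
  \<open>r3\<close> for \<open>m = 3\<close>, since \<open>r3 + 3 = - 1 / r3\<close>.\<close>

lemma J_pos_bounds:
  assumes "m \<ge> 2" "y \<in> J_pos m"
  shows "- R3 \<le> y" "y < 0" "m \<ge> 3 \<Longrightarrow> r3 \<le> y"
proof -
  have m: "real_of_int m \<ge> 2" using assms by simp
  then have 0: "r3 + of_int m \<ge> 1 + R3" by (simp add: r3_def)
  then have 1: "r3 + of_int m > 0" using R3_gt by simp
  have l: "- 1 / (r3 + of_int m) \<le> y" and u: "y \<le> - 1 / (r3 + of_int m + 1)"
    using assms by (auto simp: J_pos_def)
  have "- 1 / (r3 + of_int m + 1) < 0" using 1 by (simp add: field_simps)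
  then show "y < 0" using u by linarith
  have "1 / (r3 + of_int m) \<le> 1 / (1 + R3)"
    using 0 R3_gt by (intro divide_left_mono) auto
  then show "- R3 \<le> y" using l by (simp flip: inverse_R3)
  assume "m \<ge> 3"
  then have "r3 + of_int m \<ge> 2 + R3" by (simp add: r3_def)
  then have "1 / (r3 + of_int m) \<le> 1 / (2 + R3)"
    using R3_gt by (intro divide_left_mono) auto
  moreover have "2 + R3 = - (1 / r3)" using inverse_r3 by simp
  ultimately show "r3 \<le> y" using l by simp
qed

lemma J_star_sgn:
  assumes "y \<in> J_star m"
  shows "y < 0 \<and> m \<ge> 2 \<or> y > 0 \<and> m \<le> - 2"
  using assms J_pos_bounds(2)[of m y] J_pos_bounds(2)[of "- m" "- y"]
  by (auto simp: J_star_def split: if_splits)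

lemma J_star_nonzero: "y \<in> J_star m \<Longrightarrow> y \<noteq> 0"
  using J_star_sgn by blast

lemma J_star_bound: "y \<in> J_star m \<Longrightarrow> \<bar>y\<bar> \<le> R3"
  using J_pos_bounds(1,2)[of m y] J_pos_bounds(1,2)[of "- m" "- y"]
  by (auto simp: J_star_def split: if_splits)

text \<open>The digit \<open>2 * sgn m\<close> forbidden by the matrix belongs to the only interval
  that is not contained in the range of branch \<open>m\<close>.\<close>

lemma J_star_subset_branch_range:
  assumes "trans_matrix m n = 1" "m \<in> alphabet"
  shows "J_star n \<subseteq> branch_range m"
proof
  fix y assume y: "y \<in> J_star n"
  then have n: "n \<in> alphabet" by (simp add: mem_J_star_iff)
  have ne: "n \<noteq> 2 * sgn m" using assms(1) by (auto simp: trans_matrix_def split: if_splits)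
  from n show "y \<in> branch_range m"
  proof (cases rule: alphabet_cases)
    case 1
    then have "y \<in> J_pos n" using y by (simp add: J_star_def)
    moreover have "n \<ge> 3" if "m > 0" using that 1 ne by simp
    ultimately show ?thesis using J_pos_bounds[OF 1] r3_bounds
      by (fastforce simp: branch_range_def)
  next
    case 2
    then have "- y \<in> J_pos (- n)" using y by (auto simp: J_star_def)
    \<comment> \<open>Here \<open>m\<close> is nonzero as a letter of the alphabet, so
      \<open>sgn m = - 1\<close> and the forbidden digit is \<open>- 2\<close>.\<close>
    moreover have "- n \<ge> 3" if "\<not> m > 0"
      using that 2 ne assms(2) by (auto simp: alphabet_def sgn_if split: if_splits)
    ultimately show ?thesis using J_pos_bounds[of "- n" "- y"] 2 r3_bounds
      by (fastforce simp: branch_range_def)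
  qed
qed

lemma inv_branch_mem: "m \<in> alphabet \<Longrightarrow> w \<in> branch_range m \<Longrightarrow> inv_branch m w \<in> J_star m"
  by (simp add: mem_J_star_iff)

text \<open>The difference of reciprocals gives
  \<open>x - y = x * y * (f_branch m x - f_branch m y)\<close>, and both \<open>x\<close> and
  \<open>y\<close> have absolute value at most \<open>R3\<close>.\<close>

lemma J_star_expanding:
  assumes "x \<in> J_star m" "y \<in> J_star m"
  shows "\<bar>x - y\<bar> \<le> R3\<^sup>2 * \<bar>f_branch m x - f_branch m y\<bar>"
proof -
  have nz: "x \<noteq> 0" "y \<noteq> 0" using assms J_star_nonzero by auto
  then have "x - y = (x * y) * (f_branch m x - f_branch m y)"
    by (simp add: f_branch_def field_simps)
  then have "\<bar>x - y\<bar> = (\<bar>x\<bar> * \<bar>y\<bar>) * \<bar>f_branch m x - f_branch m y\<bar>" by (simp add: abs_mult)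
  moreover have "\<bar>x\<bar> * \<bar>y\<bar> \<le> R3\<^sup>2"
    using assms J_star_bound R3_gt unfolding power2_eq_square by (intro mult_mono) auto
  ultimately show ?thesis by (simp add: mult_right_mono)
qed

section \<open>Admissible sequences and convergence of the approximants\<close>

lemma shift_F_A: "\<xi> \<in> F_A \<Longrightarrow> shift \<xi> \<in> F_A"
  by (simp add: F_A_def shift_def)

lemma funpow_shift: "(shift ^^ n) \<xi> i = \<xi> (n + i)"
  by (induction n arbitrary: i) (simp_all add: shift_def)

lemma funpow_shift_0: "(shift ^^ n) \<xi> 0 = \<xi> n"
  by (simp add: funpow_shift)

lemma funpow_shift_F_A: "\<xi> \<in> F_A \<Longrightarrow> (shift ^^ n) \<xi> \<in> F_A"
  by (induction n) (simp_all add: shift_F_A)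

lemma F_A_D:
  assumes "\<xi> \<in> F_A"
  shows "\<xi> i \<in> alphabet" "\<xi> (Suc i) \<noteq> 2 * sgn (\<xi> i)" "J_star (\<xi> (Suc i)) \<subseteq> branch_range (\<xi> i)"
proof -
  have *: "\<xi> i \<in> alphabet" "trans_matrix (\<xi> i) (\<xi> (Suc i)) = 1" using assms by (auto simp: F_A_def)
  then show "\<xi> i \<in> alphabet" by simp
  show "\<xi> (Suc i) \<noteq> 2 * sgn (\<xi> i)" using * by (auto simp: trans_matrix_def split: if_splits)
  show "J_star (\<xi> (Suc i)) \<subseteq> branch_range (\<xi> i)" using J_star_subset_branch_range * by blast
qed

lemma approx_point_mem: "\<xi> \<in> F_A \<Longrightarrow> approx_point n \<xi> \<in> J_star (\<xi> 0)"
proof (induction n arbitrary: \<xi>)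
  case 0
  have "of_int (sgn (\<xi> 0)) * R3 \<in> branch_range (\<xi> 0)"
    using F_A_D(1)[OF 0, of 0] r3_bounds
    by (auto simp: branch_range_def alphabet_def sgn_if)
  then show ?case using F_A_D(1)[OF 0] by (simp add: inv_branch_mem)
next
  case (Suc n)
  from Suc.IH[OF shift_F_A[OF Suc.prems]] have "approx_point n (shift \<xi>) \<in> branch_range (\<xi> 0)"
    using F_A_D(3)[OF Suc.prems, of 0] by (auto simp: shift_def)
  then show ?case using F_A_D(1)[OF Suc.prems] by (simp add: inv_branch_mem)
qed

text \<open>Both approximants begin with the same inverse branches. Peeling off \<open>n\<close> of
  them gains the contraction factor each time and leaves two points of
  \<open>[- R3, R3]\<close>.\<close>

lemma approx_point_close:
  "\<xi> \<in> F_A \<Longrightarrow> n \<le> m \<Longrightarrow> \<bar>approx_point m \<xi> - approx_point n \<xi>\<bar> \<le> (R3\<^sup>2) ^ n * (2 * R3)"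
proof (induction n arbitrary: m \<xi>)
  case 0
  then show ?case
    using J_star_bound[OF approx_point_mem[OF 0(1), of m]]
      J_star_bound[OF approx_point_mem[OF 0(1), of 0]] by simp
next
  case (Suc n)
  then obtain k where m: "m = Suc k" "n \<le> k" by (metis Suc_le_D Suc_le_mono)
  have "\<bar>approx_point m \<xi> - approx_point (Suc n) \<xi>\<bar>
      \<le> R3\<^sup>2 * \<bar>approx_point k (shift \<xi>) - approx_point n (shift \<xi>)\<bar>"
    using J_star_expanding[OF approx_point_mem[OF Suc.prems(1), of m]
        approx_point_mem[OF Suc.prems(1), of "Suc n"]] m by simp
  also have "\<dots> \<le> R3\<^sup>2 * ((R3\<^sup>2) ^ n * (2 * R3))"
    using Suc.IH[OF shift_F_A[OF Suc.prems(1)] m(2)] by (intro mult_left_mono) auto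
  finally show ?case by (simp add: mult.assoc)
qed

lemma contraction_tendsto_0: "(\<lambda>n. (R3\<^sup>2) ^ n * c) \<longlonglongrightarrow> 0"
proof -
  have "R3\<^sup>2 < 1" using R3_gt R3_squared by (simp add: power2_eq_square)
  then show ?thesis by (intro tendsto_mult_left_zero LIMSEQ_power_zero) simp
qed

lemma approx_point_tendsto:
  assumes "\<xi> \<in> F_A"
  shows "(\<lambda>n. approx_point n \<xi>) \<longlonglongrightarrow> limit_point \<xi>"
proof -
  have "Cauchy (\<lambda>n. approx_point n \<xi>)"
  proof (rule metric_CauchyI)
    fix e :: real assume "e > 0"
    then have "eventually (\<lambda>n. (R3\<^sup>2) ^ n * (2 * R3) < e / 2) sequentially"
      using contraction_tendsto_0 by (intro order_tendstoD) auto
    then obtain N where N: "(R3\<^sup>2) ^ N * (2 * R3) < e / 2" by (auto simp: eventually_sequentially)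
    have "dist (approx_point m \<xi>) (approx_point N \<xi>) < e / 2" if "m \<ge> N" for m
      using approx_point_close[OF assms that] N by (simp add: dist_real_def)
    then show "\<exists>M. \<forall>m\<ge>M. \<forall>n\<ge>M. dist (approx_point m \<xi>) (approx_point n \<xi>) < e"
      by (meson dist_triangle_half_l)
  qed
  then show ?thesis
    unfolding limit_point_def using Cauchy_convergent_iff convergent_LIMSEQ_iff by blast
qed

lemma closed_J_star: "closed (J_star m)"
proof -
  have "uminus ` J_pos (- m) = {1 / (r3 - of_int m + 1) .. 1 / (r3 - of_int m)}"
    by (simp add: J_pos_def image_uminus_atLeastAtMost)
  then show ?thesis by (simp add: J_star_def J_pos_def)
qed

lemma limit_point_mem: "\<xi> \<in> F_A \<Longrightarrow> limit_point \<xi> \<in> J_star (\<xi> 0)"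
  by (rule closed_sequentially[OF closed_J_star _ approx_point_tendsto]) (simp_all add: approx_point_mem)

text \<open>The branch removes the first digit from every approximant, and it is continuous at the
  limit because the limit is nonzero.\<close>

lemma f_branch_limit_point:
  assumes "\<xi> \<in> F_A"
  shows "f_branch (\<xi> 0) (limit_point \<xi>) = limit_point (shift \<xi>)"
proof (rule LIMSEQ_unique)
  have "limit_point \<xi> \<noteq> 0" using limit_point_mem[OF assms] J_star_nonzero by blast
  then have "(\<lambda>n. f_branch (\<xi> 0) (approx_point n \<xi>)) \<longlonglongrightarrow> f_branch (\<xi> 0) (limit_point \<xi>)"
    unfolding f_branch_def by (intro tendsto_intros approx_point_tendsto assms)
  then show "(\<lambda>n. f_branch (\<xi> 0) (approx_point (Suc n) \<xi>)) \<longlonglongrightarrow> f_branch (\<xi> 0) (limit_point \<xi>)"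
    by (rule LIMSEQ_Suc)
  show "(\<lambda>n. f_branch (\<xi> 0) (approx_point (Suc n) \<xi>)) \<longlonglongrightarrow> limit_point (shift \<xi>)"
    using approx_point_tendsto[OF shift_F_A[OF assms]] by simp
qed

section \<open>Existence and uniqueness of the point following a sequence\<close>

lemma follows_branches_iff:
  "follows_branches \<xi> x \<longleftrightarrow> (\<forall>l. branch_comp \<xi> l x \<in> J_star (\<xi> l))"
proof -
  have "(\<forall>l. P l) \<longleftrightarrow> P 0 \<and> (\<forall>l\<ge>1. P l)" for P :: "nat \<Rightarrow> bool"
    by (metis One_nat_def Suc_leI gr_zeroI)
  from this[of "\<lambda>l. branch_comp \<xi> l x \<in> J_star (\<xi> l)"] show ?thesis
    by (auto simp: follows_branches_def)
qed

lemma branch_comp_limit_point: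
  "\<xi> \<in> F_A \<Longrightarrow> branch_comp \<xi> l (limit_point \<xi>) = limit_point ((shift ^^ l) \<xi>)"
proof (induction l)
  case (Suc l)
  then show ?case
    using f_branch_limit_point[OF funpow_shift_F_A, of \<xi> l] by (simp add: funpow_shift_0)
qed simp

lemma follows_branches_limit_point:
  assumes "\<xi> \<in> F_A"
  shows "follows_branches \<xi> (limit_point \<xi>)"
proof -
  have "limit_point ((shift ^^ l) \<xi>) \<in> J_star (\<xi> l)" for l
    using limit_point_mem[OF funpow_shift_F_A[OF assms], of l] by (simp add: funpow_shift_0)
  then show ?thesis using assms by (simp add: follows_branches_iff branch_comp_limit_point)
qed

text \<open>The two orbits share an interval at every time, so their distance grows at least by the
  factor \<open>1 / R3\<^sup>2\<close> per step; yet it never exceeds \<open>2 * R3\<close>.\<close>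

lemma follows_branches_unique:
  assumes "follows_branches \<xi> x" "follows_branches \<xi> y"
  shows "x = y"
proof -
  have J: "branch_comp \<xi> l x \<in> J_star (\<xi> l)" "branch_comp \<xi> l y \<in> J_star (\<xi> l)" for l
    using assms by (auto simp: follows_branches_iff)
  have *: "\<bar>x - y\<bar> \<le> (R3\<^sup>2) ^ n * \<bar>branch_comp \<xi> n x - branch_comp \<xi> n y\<bar>" for n
  proof (induction n)
    case (Suc n)
    also have "(R3\<^sup>2) ^ n * \<bar>branch_comp \<xi> n x - branch_comp \<xi> n y\<bar>
       \<le> (R3\<^sup>2) ^ n * (R3\<^sup>2 * \<bar>branch_comp \<xi> (Suc n) x - branch_comp \<xi> (Suc n) y\<bar>)"
      using J_star_expanding[OF J] by (intro mult_left_mono) auto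
    finally show ?case by (simp add: mult_ac)
  qed simp
  have "\<bar>x - y\<bar> \<le> (R3\<^sup>2) ^ n * (2 * R3)" for n
  proof -
    have "\<bar>branch_comp \<xi> n x - branch_comp \<xi> n y\<bar> \<le> 2 * R3"
      using J_star_bound[OF J(1)[of n]] J_star_bound[OF J(2)[of n]] by linarith
    then show ?thesis using *[of n] by (meson mult_left_mono order_trans zero_le_power zero_le_power2)
  qed
  then have "\<bar>x - y\<bar> \<le> 0"
    by (intro LIMSEQ_le_const[OF contraction_tendsto_0]) blast
  then show ?thesis by simp
qed

lemma follows_branches_I_R3: "follows_branches \<xi> x \<Longrightarrow> x \<in> I_R3"
  using J_star_bound[of x "\<xi> 0"] by (auto simp: follows_branches_def I_R3_def)

lemma decoding_eq:
  assumes "\<xi> \<in> F_A"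
  shows "\<exists>!x. x \<in> I_R3 \<and> follows_branches \<xi> x" "decoding \<xi> = limit_point \<xi>"
proof -
  have *: "limit_point \<xi> \<in> I_R3 \<and> follows_branches \<xi> (limit_point \<xi>)"
    using follows_branches_limit_point[OF assms] follows_branches_I_R3 by blast
  then show "\<exists>!x. x \<in> I_R3 \<and> follows_branches \<xi> x" using follows_branches_unique by blast
  show "decoding \<xi> = limit_point \<xi>"
    unfolding decoding_def using * follows_branches_unique by blast
qed

section \<open>Rounding and the map \<open>f_star\<close>\<close>

lemma nearest_int_nonneg_eq: "nearest_int_nonneg x = \<lfloor>x - r3\<rfloor>"
  unfolding nearest_int_nonneg_def
proof (rule the_equality)
  show "of_int \<lfloor>x - r3\<rfloor> + r3 \<le> x \<and> x < of_int \<lfloor>x - r3\<rfloor> + R3"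
    using r3_bounds by linarith
  show "n = \<lfloor>x - r3\<rfloor>" if "of_int n + r3 \<le> x \<and> x < of_int n + R3" for n
    using that r3_bounds by linarith
qed

lemma f_star_eq_branch:
  "y \<noteq> 0 \<Longrightarrow> f_star y = f_branch (nearest_int_star (- 1 / y)) y"
  by (simp add: f_star_def f_branch_def)

text \<open>Subtracting \<open>\<lfloor>x - r3\<rfloor>\<close> from \<open>x\<close> leaves a value
  in \<open>[r3, R3)\<close>, and rounding is odd. The strict inequalities decide which of two
  adjacent branches \<open>f_star\<close> uses at a common endpoint.\<close>

lemma f_star_bounds:
  shows "y < 0 \<Longrightarrow> r3 \<le> f_star y \<and> f_star y < R3"
    and "y > 0 \<Longrightarrow> - R3 < f_star y \<and> f_star y \<le> - r3"
proof -
  assume "y < 0"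
  then have "- 1 / y \<ge> 0" by (simp add: field_simps)
  then have "f_star y = - 1 / y - \<lfloor>- 1 / y - r3\<rfloor>"
    using \<open>y < 0\<close> by (simp add: f_star_def nearest_int_star_def nearest_int_nonneg_eq)
  then show "r3 \<le> f_star y \<and> f_star y < R3" using r3_bounds by linarith
next
  assume "y > 0"
  then have "\<not> - 1 / y \<ge> 0" by (simp add: field_simps)
  then have "f_star y = - 1 / y + \<lfloor>1 / y - r3\<rfloor>"
    using \<open>y > 0\<close> by (simp add: f_star_def nearest_int_star_def nearest_int_nonneg_eq)
  then show "- R3 < f_star y \<and> f_star y \<le> - r3" using r3_bounds by (simp, linarith)
qed

lemma f_star_I_R3: "f_star y \<in> I_R3"
proof (cases "y = 0")
  case True
  then show ?thesis using R3_gt by (simp add: I_R3_def f_star_def)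
next
  case False
  then show ?thesis using f_star_bounds[of y] r3_bounds by (fastforce simp: I_R3_def)
qed

text \<open>From \<open>\<bar>y\<bar> \<le> R3\<close> follows
  \<open>1 / \<bar>y\<bar> \<ge> 1 + R3 = 2 + r3\<close>, so the digits 0, 1 and \<open>- 1\<close>
  never occur.\<close>

lemma nearest_int_star_sgn:
  assumes "y \<in> I_R3" "y \<noteq> 0"
  shows "y < 0 \<Longrightarrow> nearest_int_star (- 1 / y) \<ge> 2"
    and "y > 0 \<Longrightarrow> nearest_int_star (- 1 / y) \<le> - 2"
proof -
  have "1 / \<bar>y\<bar> \<ge> 1 / R3" using assms by (intro divide_left_mono) (auto simp: I_R3_def)
  then have 1: "1 / \<bar>y\<bar> \<ge> 2 + r3" using inverse_R3 by (simp add: r3_def)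
  then have "1 / \<bar>y\<bar> - r3 \<ge> 2" by simp
  then have "\<lfloor>1 / \<bar>y\<bar> - r3\<rfloor> \<ge> 2" by linarith
  then show "y < 0 \<Longrightarrow> nearest_int_star (- 1 / y) \<ge> 2"
    and "y > 0 \<Longrightarrow> nearest_int_star (- 1 / y) \<le> - 2"
    by (auto simp: nearest_int_star_def nearest_int_nonneg_eq field_simps)
qed

lemma nearest_int_star_J_star:
  assumes "y \<in> I_R3" "y \<noteq> 0"
  shows "y \<in> J_star (nearest_int_star (- 1 / y))"
  using nearest_int_star_sgn[OF assms] f_star_bounds[of y] f_star_eq_branch[OF assms(2)] assms(2)
  by (cases "y < 0") (auto simp: mem_J_star_iff alphabet_def branch_range_def)

text \<open>Adjacent intervals overlap in a point at which the branch belonging to one of them takes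
  the value \<open>\<plusminus>R3\<close> and \<open>f_star\<close>, which is the other branch, takes the value \<open>\<plusminus>r3\<close>.\<close>

lemma J_star_index_unique:
  assumes "y \<in> J_star m" and "f_branch m y \<notin> {R3, - R3} \<or> f_star y \<notin> {r3, - r3}"
  shows "nearest_int_star (- 1 / y) = m" "f_star y = f_branch m y"
proof -
  let ?n = "nearest_int_star (- 1 / y)"
  have nz: "y \<noteq> 0" using assms(1) J_star_nonzero by blast
  \<comment> \<open>Two values in a closed interval of length 1 that differ by an integer are equal
    or are its two endpoints; the second assumption excludes the endpoints.\<close>
  have d: "f_branch m y - f_star y = of_int (?n - m)"
    using nz by (simp add: f_star_eq_branch f_branch_def)
  have r: "f_branch m y \<in> branch_range m" using assms(1) by (simp add: mem_J_star_iff)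
  have "?n - m = 0"
    using J_star_sgn[OF assms(1)]
  proof
    assume *: "y < 0 \<and> m \<ge> 2"
    then have "r3 \<le> f_branch m y" "f_branch m y \<le> R3" using r by (auto simp: branch_range_def)
    with f_star_bounds(1)[of y] * have "- 1 < real_of_int (?n - m)" "real_of_int (?n - m) \<le> 1"
      "real_of_int (?n - m) = 1 \<longrightarrow> f_branch m y = R3 \<and> f_star y = r3"
      using d r3_bounds by linarith+
    moreover have "of_int (?n - m) \<noteq> (1::real)" using calculation(3) assms(2) by auto
    ultimately show ?thesis by linarith
  next
    assume *: "y > 0 \<and> m \<le> - 2"
    then have "- R3 \<le> f_branch m y" "f_branch m y \<le> - r3" using r by (auto simp: branch_range_def)
    with f_star_bounds(2)[of y] * have "- 1 \<le> real_of_int (?n - m)" "real_of_int (?n - m) < 1"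
      "real_of_int (?n - m) = - 1 \<longrightarrow> f_branch m y = - R3 \<and> f_star y = - r3"
      using d r3_bounds by linarith+
    moreover have "of_int (?n - m) \<noteq> (- 1::real)" using calculation(3) assms(2) by auto
    ultimately show ?thesis by linarith
  qed
  then show "?n = m" by simp
  then show "f_star y = f_branch m y" using nz by (simp add: f_star_eq_branch)
qed

section \<open>Codes of points outside the boundary set\<close>

lemma f_star_boundary:
  assumes "x \<in> I_R3 - boundary_M"
  shows "f_star x \<in> I_R3 - boundary_M"
proof -
  have *: "(f_star ^^ n) (f_star x) = (f_star ^^ Suc n) x" for n by (simp add: funpow_swap1)
  have "(f_star ^^ Suc n) x \<notin> {r3, - r3, 0}" for n
    using assms unfolding boundary_M_def by blast
  then show ?thesis using f_star_I_R3[of x] by (simp add: boundary_M_def *)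
qed

lemma funpow_f_star_boundary: "x \<in> I_R3 - boundary_M \<Longrightarrow> (f_star ^^ n) x \<in> I_R3 - boundary_M"
  by (induction n) (use f_star_boundary in auto)

lemma not_boundary_D: "x \<in> I_R3 - boundary_M \<Longrightarrow> x \<notin> {r3, - r3, 0}"
  unfolding boundary_M_def by (auto dest!: spec[of _ 0])

text \<open>An index is ambiguous only where \<open>f_star\<close> takes the value \<open>r3\<close>
  or \<open>- r3\<close>. The orbit never meets these values, so every digit is forced to be the
  nearest integer.\<close>

lemma is_itinerary_iff:
  assumes "x \<in> I_R3 - boundary_M"
  shows "is_itinerary x \<xi> \<longleftrightarrow> \<xi> = (\<lambda>i. nearest_int_star (- 1 / (f_star ^^ i) x))"
proof
  let ?y = "\<lambda>i. (f_star ^^ i) x"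
  have y: "?y i \<in> I_R3" "?y i \<notin> {r3, - r3, 0}" for i
    using funpow_f_star_boundary[OF assms, of i] not_boundary_D by auto
  {
    assume "is_itinerary x \<xi>"
    then have J: "?y i \<in> J_star (\<xi> i)" for i by (simp add: is_itinerary_def)
    have "f_star (?y i) \<notin> {r3, - r3}" for i using y(2)[of "Suc i"] by simp
    then show "\<xi> = (\<lambda>i. nearest_int_star (- 1 / ?y i))"
      using J_star_index_unique(1)[OF J] by fastforce
  }
  show "is_itinerary x \<xi>" if "\<xi> = (\<lambda>i. nearest_int_star (- 1 / ?y i))"
    using nearest_int_star_J_star[OF y(1)] y(2) that
    by (auto simp: is_itinerary_def mem_J_star_iff)
qed

lemma is_itinerary_coding:
  assumes "x \<in> I_R3 - boundary_M"
  shows "is_itinerary x \<xi> \<longleftrightarrow> \<xi> = coding x"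
  unfolding coding_def is_itinerary_iff[OF assms] by simp

lemma is_itinerary_shift: "is_itinerary x \<xi> \<Longrightarrow> is_itinerary (f_star x) (shift \<xi>)"
  unfolding is_itinerary_def shift_def by (metis comp_apply funpow_Suc_right)

lemma coding_f_star:
  assumes "x \<in> I_R3 - boundary_M"
  shows "coding (f_star x) = shift (coding x)"
  using is_itinerary_shift is_itinerary_coding f_star_boundary assms by metis

text \<open>As the next point of the orbit is not \<open>r3\<close> or \<open>- r3\<close>,
  \<open>f_star\<close> agrees along the orbit with the branch chosen by the code.\<close>

lemma coding_branch:
  assumes "x \<in> I_R3 - boundary_M"
  shows "(f_star ^^ i) x \<in> J_star (coding x i)"
    and "(f_star ^^ Suc i) x = f_branch (coding x i) ((f_star ^^ i) x)"
proof -
  show J: "(f_star ^^ i) x \<in> J_star (coding x i)"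
    using is_itinerary_coding[OF assms, of "coding x"] by (simp add: is_itinerary_def)
  show "(f_star ^^ Suc i) x = f_branch (coding x i) ((f_star ^^ i) x)"
    using J_star_index_unique(2)[OF J] not_boundary_D[OF funpow_f_star_boundary[OF assms, of "Suc i"]]
    by simp
qed

lemma follows_branches_coding:
  assumes "x \<in> I_R3 - boundary_M"
  shows "follows_branches (coding x) x"
proof -
  have "branch_comp (coding x) l x = (f_star ^^ l) x" for l
  proof (induction l)
    case (Suc l)
    then show ?case using coding_branch(2)[OF assms, of l] by simp
  qed simp
  then show ?thesis using coding_branch(1)[OF assms] by (simp add: follows_branches_iff)
qed

lemma J_star_2: "J_star 2 = {- R3..r3}" "J_star (- 2) = {- r3..R3}"
proof -
  have *: "J_pos 2 = {- R3..r3}"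
    using inverse_R3 inverse_r3 R3_gt R3_squared by (auto simp: J_pos_def r3_def field_simps)
  then show "J_star 2 = {- R3..r3}" by (simp add: J_star_def)
  show "J_star (- 2) = {- r3..R3}" using * by (simp add: J_star_def)
qed

text \<open>After a positive digit the orbit lies in \<open>[r3, R3)\<close>, which meets
  \<open>J_star 2 = [- R3, r3]\<close> only in \<open>r3\<close>, a value the orbit avoids. Negative
  digits are symmetric.\<close>

lemma coding_F_A:
  assumes "x \<in> I_R3 - boundary_M"
  shows "coding x \<in> F_A"
proof -
  have a: "coding x i \<in> alphabet" for i using coding_branch(1)[OF assms] by (simp add: mem_J_star_iff)
  have "coding x (Suc i) \<noteq> 2 * sgn (coding x i)" for i
  proof
    assume *: "coding x (Suc i) = 2 * sgn (coding x i)"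
    let ?y = "(f_star ^^ i) x"
    have J: "f_star ?y \<in> J_star (2 * sgn (coding x i))"
      using coding_branch(1)[OF assms, of "Suc i"] * by simp
    have nb: "f_star ?y \<notin> {r3, - r3}"
      using not_boundary_D[OF funpow_f_star_boundary[OF assms, of "Suc i"]] by simp
    from J_star_sgn[OF coding_branch(1)[OF assms, of i]] show False
      using J nb f_star_bounds[of ?y] J_star_2 by (auto simp: sgn_if split: if_splits)
  qed
  then show ?thesis using a by (simp add: F_A_def trans_matrix_def)
qed

lemma limit_point_coding: "x \<in> I_R3 - boundary_M \<Longrightarrow> limit_point (coding x) = x"
  using follows_branches_unique follows_branches_coding follows_branches_limit_point coding_F_A
  by blast

section \<open>Endpoints and the constant sequences\<close>

lemma f_branch_special:
  "f_branch m r3 = 2 + R3 - of_int m" "f_branch m (- r3) = - 2 - R3 - of_int m"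
  "f_branch m R3 = - 1 - R3 - of_int m" "f_branch m (- R3) = 1 + R3 - of_int m"
  by (simp_all add: f_branch_def inverse_r3 inverse_R3)

text \<open>\<open>r3\<close> is the fixed point of branch 3 and the left endpoint of
  \<open>J_star 3\<close>, hence it follows the constant sequence 3; likewise for
  \<open>- r3\<close>.\<close>

lemma limit_point_r3_seq: "limit_point r3_seq = r3" "limit_point minus_r3_seq = - r3"
proof -
  have f: "f_branch 3 r3 = r3" "f_branch (- 3) (- r3) = - r3"
    by (simp_all add: f_branch_special) (simp_all add: r3_def)
  have c: "branch_comp r3_seq l r3 = r3" "branch_comp minus_r3_seq l (- r3) = - r3" for l
    by (induction l) (simp_all add: f r3_seq_def minus_r3_seq_def)
  have "r3 \<in> J_star 3" "- r3 \<in> J_star (- 3)"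
    using f r3_bounds by (auto simp: mem_J_star_iff alphabet_def branch_range_def)
  with c have "follows_branches r3_seq r3" "follows_branches minus_r3_seq (- r3)"
    by (simp_all add: follows_branches_iff r3_seq_def minus_r3_seq_def)
  moreover have "r3_seq \<in> F_A" "minus_r3_seq \<in> F_A"
    by (auto simp: F_A_def r3_seq_def minus_r3_seq_def alphabet_def trans_matrix_def)
  ultimately show "limit_point r3_seq = r3" "limit_point minus_r3_seq = - r3"
    using follows_branches_unique follows_branches_limit_point by blast+
qed

lemma funpow_coding:
  "x \<in> I_R3 - boundary_M \<Longrightarrow> (shift ^^ n) (coding x) = coding ((f_star ^^ n) x)"
  by (induction n) (simp_all add: coding_f_star[OF funpow_f_star_boundary] del: Diff_iff)

text \<open>A constant tail 3 or \<open>- 3\<close> of the code would put the corresponding orbit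
  point at \<open>r3\<close> or \<open>- r3\<close>.\<close>

lemma coding_F_A_reg:
  assumes "x \<in> I_R3 - boundary_M"
  shows "coding x \<in> F_A_reg"
proof -
  have "(shift ^^ n) (coding x) \<notin> {r3_seq, minus_r3_seq}" for n
    using limit_point_coding[OF funpow_f_star_boundary[OF assms, of n]]
      not_boundary_D[OF funpow_f_star_boundary[OF assms, of n]]
      limit_point_r3_seq funpow_coding[OF assms, of n] by auto
  then show ?thesis using coding_F_A[OF assms] by (simp add: F_A_reg_def)
qed

section \<open>Sequences without a constant tail 3 or \<open>- 3\<close>\<close>

lemma shift_F_A_reg:
  assumes "\<xi> \<in> F_A_reg"
  shows "shift \<xi> \<in> F_A_reg"
proof -
  have *: "(shift ^^ n) (shift \<xi>) = (shift ^^ Suc n) \<xi>" for n by (simp add: funpow_swap1)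
  have "(shift ^^ Suc n) \<xi> \<notin> {r3_seq, minus_r3_seq}" for n
    using assms unfolding F_A_reg_def by blast
  then show ?thesis using assms shift_F_A[of \<xi>] by (simp add: F_A_reg_def *)
qed

lemma funpow_shift_F_A_reg: "\<xi> \<in> F_A_reg \<Longrightarrow> (shift ^^ n) \<xi> \<in> F_A_reg"
  by (induction n) (simp_all add: shift_F_A_reg)

lemma r3_seq_notin_F_A_reg: "r3_seq \<notin> F_A_reg" "minus_r3_seq \<notin> F_A_reg"
  by (auto simp: F_A_reg_def intro: exI[of _ 0])

text \<open>\<open>r3\<close> is the common endpoint of \<open>J_star 2\<close> and
  \<open>J_star 3\<close>, whereas \<open>- R3\<close> is the outer endpoint of
  \<open>J_star 2\<close>; the other two cases are mirror images.\<close>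

lemma J_star_special:
  shows "r3 \<in> J_star m \<Longrightarrow> m = 2 \<or> m = 3" "- r3 \<in> J_star m \<Longrightarrow> m = - 2 \<or> m = - 3"
    and "R3 \<in> J_star m \<Longrightarrow> m = - 2" "- R3 \<in> J_star m \<Longrightarrow> m = 2"
proof -
  note J = J_star_sgn[of _ m] mem_J_star_iff[of _ m]
  note b = r3_bounds f_branch_special
  show "m = 2 \<or> m = 3" if "r3 \<in> J_star m"
    using J[of r3] that b by (auto simp: branch_range_def)
  show "m = - 2 \<or> m = - 3" if "- r3 \<in> J_star m"
    using J[of "- r3"] that b by (auto simp: branch_range_def)
  show "m = - 2" if "R3 \<in> J_star m"
    using J[of R3] that b by (auto simp: branch_range_def)
  show "m = 2" if "- R3 \<in> J_star m"
    using J[of "- R3"] that b by (auto simp: branch_range_def)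
qed

text \<open>At \<open>r3\<close> only the digits 2 and 3 are possible. Once 3 is chosen, its branch
  fixes \<open>r3\<close> and the matrix forbids 2 as the next digit, so 3 repeats forever.\<close>

lemma eq_r3_seq:
  assumes "\<xi> \<in> F_A" "limit_point \<xi> = r3" "\<xi> 0 \<noteq> 2"
  shows "\<xi> = r3_seq"
proof -
  have "\<xi> n = 3 \<and> limit_point ((shift ^^ n) \<xi>) = r3" for n
  proof (induction n)
    case 0
    then show ?case using assms limit_point_mem[OF assms(1)] J_star_special(1) by fastforce
  next
    case (Suc n)
    note F = funpow_shift_F_A[OF assms(1)]
    have *: "limit_point ((shift ^^ Suc n) \<xi>) = r3"
      using f_branch_limit_point[OF F, of n] Suc f_branch_special(1)[of 3] r3_bounds(3)
      by (simp add: funpow_shift_0)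
    then have "\<xi> (Suc n) = 2 \<or> \<xi> (Suc n) = 3"
      using limit_point_mem[OF F, of "Suc n"] J_star_special(1) funpow_shift_0 by metis
    then show ?case using * F_A_D(2)[OF assms(1), of n] Suc by auto
  qed
  then show ?thesis by (auto simp: r3_seq_def)
qed

lemma eq_minus_r3_seq:
  assumes "\<xi> \<in> F_A" "limit_point \<xi> = - r3" "\<xi> 0 \<noteq> - 2"
  shows "\<xi> = minus_r3_seq"
proof -
  have "\<xi> n = - 3 \<and> limit_point ((shift ^^ n) \<xi>) = - r3" for n
  proof (induction n)
    case 0
    then show ?case using assms limit_point_mem[OF assms(1)] J_star_special(2) by fastforce
  next
    case (Suc n)
    note F = funpow_shift_F_A[OF assms(1)]
    have *: "limit_point ((shift ^^ Suc n) \<xi>) = - r3"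
      using f_branch_limit_point[OF F, of n] Suc f_branch_special(2)[of "- 3"] r3_bounds(3)
      by (simp add: funpow_shift_0)
    then have "\<xi> (Suc n) = - 2 \<or> \<xi> (Suc n) = - 3"
      using limit_point_mem[OF F, of "Suc n"] J_star_special(2) funpow_shift_0 by metis
    then show ?case using * F_A_D(2)[OF assms(1), of n] Suc by auto
  qed
  then show ?thesis by (auto simp: minus_r3_seq_def)
qed

lemma F_A_reg_subset: "F_A_reg \<subseteq> F_A"
  by (auto simp: F_A_reg_def)

text \<open>\<open>R3\<close> forces the digit \<open>- 2\<close>, whose branch maps it to
  \<open>- r3\<close>. A second \<open>- 2\<close> is forbidden, so the tail would be constantly
  \<open>- 3\<close>. The argument for \<open>- R3\<close> is the reflection.\<close>

lemma limit_point_reg_R3: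
  assumes "\<xi> \<in> F_A_reg"
  shows "limit_point \<xi> \<notin> {R3, - R3}"
proof -
  have F: "\<xi> \<in> F_A" "shift \<xi> \<in> F_A" using assms F_A_reg_subset shift_F_A by auto
  have ne: "shift \<xi> \<noteq> r3_seq" "shift \<xi> \<noteq> minus_r3_seq"
    using shift_F_A_reg[OF assms] r3_seq_notin_F_A_reg by auto
  have "limit_point \<xi> \<noteq> R3"
  proof
    assume *: "limit_point \<xi> = R3"
    then have 0: "\<xi> 0 = - 2" using limit_point_mem[OF F(1)] J_star_special(3) by simp
    then have "limit_point (shift \<xi>) = - r3"
      using f_branch_limit_point[OF F(1)] * f_branch_special(3)[of "- 2"] by (simp add: r3_def)
    moreover have "shift \<xi> 0 \<noteq> - 2" using F_A_D(2)[OF F(1), of 0] 0 by (simp add: shift_def)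
    ultimately show False using eq_minus_r3_seq F(2) ne by blast
  qed
  moreover have "limit_point \<xi> \<noteq> - R3"
  proof
    assume *: "limit_point \<xi> = - R3"
    then have 0: "\<xi> 0 = 2" using limit_point_mem[OF F(1)] J_star_special(4) by simp
    then have "limit_point (shift \<xi>) = r3"
      using f_branch_limit_point[OF F(1)] * f_branch_special(4)[of 2] by (simp add: r3_def)
    moreover have "shift \<xi> 0 \<noteq> 2" using F_A_D(2)[OF F(1), of 0] 0 by (simp add: shift_def)
    ultimately show False using eq_r3_seq F(2) ne by blast
  qed
  ultimately show ?thesis by simp
qed

text \<open>At \<open>r3\<close>, the digit 2 would lead to \<open>R3\<close>, which is impossible
  for the shifted sequence, and any other first digit forces the constant sequence 3.\<close>

lemma limit_point_reg_r3:
  assumes "\<xi> \<in> F_A_reg"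
  shows "limit_point \<xi> \<notin> {r3, - r3}"
proof -
  have F: "\<xi> \<in> F_A" using assms F_A_reg_subset by auto
  have ne: "\<xi> \<noteq> r3_seq" "\<xi> \<noteq> minus_r3_seq" using assms r3_seq_notin_F_A_reg by auto
  have R: "limit_point (shift \<xi>) \<notin> {R3, - R3}"
    using limit_point_reg_R3 shift_F_A_reg assms by blast
  have "limit_point \<xi> \<noteq> r3"
    using eq_r3_seq[OF F] ne R f_branch_limit_point[OF F] f_branch_special(1)[of 2]
    by (cases "\<xi> 0 = 2") auto
  moreover have "limit_point \<xi> \<noteq> - r3"
    using eq_minus_r3_seq[OF F] ne R f_branch_limit_point[OF F] f_branch_special(2)[of "- 2"]
    by (cases "\<xi> 0 = - 2") auto
  ultimately show ?thesis by simp
qed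

section \<open>Orbits of limit points and bijectivity\<close>

lemma funpow_f_star_limit_point:
  assumes "\<xi> \<in> F_A_reg"
  shows "(f_star ^^ n) (limit_point \<xi>) = limit_point ((shift ^^ n) \<xi>)"
proof (induction n)
  case (Suc n)
  let ?\<eta> = "(shift ^^ n) \<xi>"
  have reg: "?\<eta> \<in> F_A_reg" by (rule funpow_shift_F_A_reg[OF assms])
  then have F: "?\<eta> \<in> F_A" using F_A_reg_subset by blast
  \<comment> \<open>The branch value is the limit point of the shifted sequence, hence not
    \<open>R3\<close> or \<open>- R3\<close>; this rules out the overlap points where
    \<open>f_star\<close> differs from the branch.\<close>
  have "f_star (limit_point ?\<eta>) = f_branch (?\<eta> 0) (limit_point ?\<eta>)"
    using J_star_index_unique(2)[OF limit_point_mem[OF F]] f_branch_limit_point[OF F]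
      limit_point_reg_R3[OF shift_F_A_reg[OF reg]] by simp
  then show ?case using Suc f_branch_limit_point[OF F] by simp
qed simp

lemma limit_point_reg:
  assumes "\<xi> \<in> F_A_reg"
  shows "limit_point \<xi> \<in> I_R3 - boundary_M" "is_itinerary (limit_point \<xi>) \<xi>"
proof -
  have reg: "(shift ^^ n) \<xi> \<in> F_A_reg" for n by (rule funpow_shift_F_A_reg[OF assms])
  then have F: "(shift ^^ n) \<xi> \<in> F_A" for n using F_A_reg_subset by blast
  have "(f_star ^^ n) (limit_point \<xi>) \<notin> {r3, - r3, 0}" for n
    using limit_point_reg_r3[OF reg, of n] J_star_nonzero[OF limit_point_mem[OF F], of n]
    by (simp add: funpow_f_star_limit_point[OF assms])
  moreover have "limit_point \<xi> \<in> I_R3"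
    using follows_branches_I_R3[OF follows_branches_limit_point] F[of 0] by simp
  ultimately show "limit_point \<xi> \<in> I_R3 - boundary_M" by (auto simp: boundary_M_def)
  have "limit_point ((shift ^^ i) \<xi>) \<in> J_star (\<xi> i)" for i
    using limit_point_mem[OF F, of i] by (simp add: funpow_shift_0)
  then show "is_itinerary (limit_point \<xi>) \<xi>"
    by (simp add: is_itinerary_def funpow_f_star_limit_point[OF assms] mem_J_star_iff)
qed

lemma coding_limit_point: "\<xi> \<in> F_A_reg \<Longrightarrow> coding (limit_point \<xi>) = \<xi>"
  using is_itinerary_coding limit_point_reg by metis

lemma bij_betw_coding: "bij_betw coding (I_R3 - boundary_M) F_A_reg"
proof (rule bij_betw_byWitness[where f' = limit_point])
  show "coding ` (I_R3 - boundary_M) \<subseteq> F_A_reg" using coding_F_A_reg by blast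
  show "limit_point ` F_A_reg \<subseteq> I_R3 - boundary_M" using limit_point_reg(1) by blast
qed (simp_all add: limit_point_coding coding_limit_point)

theorem lemma4p3p1:
  shows "(\<forall>x \<in> I_R3 - boundary_M. \<exists>!\<xi>. is_itinerary x \<xi>)
    \<and> bij_betw coding (I_R3 - boundary_M) F_A_reg
    \<and> (\<forall>x \<in> I_R3 - boundary_M.
          f_star x \<in> I_R3 - boundary_M \<and> coding (f_star x) = shift (coding x))
    \<and> (\<forall>\<xi> \<in> F_A. \<exists>!x. x \<in> I_R3 \<and> follows_branches \<xi> x)
    \<and> (\<forall>\<xi> \<in> F_A_reg. decoding \<xi> = inv_into (I_R3 - boundary_M) coding \<xi>)"
proof (intro conjI ballI)
  \<comment> \<open>Both maps agree with \<open>limit_point\<close> on the regular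
    sequences.\<close>
  fix \<xi> assume reg: "\<xi> \<in> F_A_reg"
  then have "decoding \<xi> = limit_point \<xi>" using decoding_eq(2) F_A_reg_subset by blast
  moreover have "inv_into (I_R3 - boundary_M) coding \<xi> = limit_point \<xi>"
    using bij_betw_coding limit_point_reg(1)[OF reg] coding_limit_point[OF reg]
    by (intro inv_into_f_eq) (auto simp: bij_betw_def)
  ultimately show "decoding \<xi> = inv_into (I_R3 - boundary_M) coding \<xi>" by simp
next
  fix x assume x: "x \<in> I_R3 - boundary_M"
  show "\<exists>!\<xi>. is_itinerary x \<xi>" by (simp add: is_itinerary_coding[OF x])
  show "f_star x \<in> I_R3 - boundary_M" by (rule f_star_boundary[OF x])
  show "coding (f_star x) = shift (coding x)" by (rule coding_f_star[OF x])
next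
  show "\<exists>!x. x \<in> I_R3 \<and> follows_branches \<xi> x" if "\<xi> \<in> F_A" for \<xi>
    by (rule decoding_eq(1)[OF that])
qed (rule bij_betw_coding)

end
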